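(* Let $(K,v)$ be a valued field with valuation ring $\mathcal{O}_v$ and maximal ideal $\mathcal{M}_v$ of $\mathcal{O}_v$. 1) Let $I_1,I_2$ be $\mathcal{O}_v$-ideals with $I_2\subsetneq I_1$. Then the annihilator of $I_1/I_2$ is equal to $\mathcal{M}_v$ if and only if $I_1$ is principal and $I_2=I_1\mathcal{M}_v$. 2) Let $I,J$ be $\mathcal{O}_v$-ideals with $J\subsetneq\mathcal{O}_v$. Then the annihilator of $I/IJ$ is equal to $\mathcal{M}_v$ if and only if $I$ is principal and $J=\mathcal{M}_v$.
   Context: An $\mathcal{O}_v$-ideal means a nonzero $\mathcal{O}_v$-submodule $I\subsetneq K$ (so fractional ideals are included); it is principal if it is of the form $a\mathcal{O}_v$ with $a\in K$. The annihilator of $I_1/I_2$ is $I_2:I_1:=\{a\in K\mid aI_1\subseteq I_2\}$, which for $I_2\subsetneq I_1$ coincides with the annihilator of the $\mathcal{O}_v$-module $I_1/I_2$ in $\mathcal{O}_v$. *)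

theory Defs
  imports Main "HOL.Hull"
begin

text \<open>
  A (Krull) valuation on a field, written additively with values in an arbitrary linearly
  ordered abelian group; the group may be larger than the value group \<open>v K\<close>. Instead of adjoining
  an element \<open>\<infinity> = v 0\<close> to the group, we leave \<open>v 0\<close> unconstrained and treat \<open>0\<close> separately.
\<close>

definition valuation :: "('k::field \<Rightarrow> 'g::linordered_ab_group_add) \<Rightarrow> bool" where
  "valuation v \<longleftrightarrow>
     (\<forall>x y. x \<noteq> 0 \<longrightarrow> y \<noteq> 0 \<longrightarrow> v (x * y) = v x + v y) \<and>
     (\<forall>x y. x \<noteq> 0 \<longrightarrow> y \<noteq> 0 \<longrightarrow> x + y \<noteq> 0 \<longrightarrow> min (v x) (v y) \<le> v (x + y))"

definition valuation_ring :: "('k::field \<Rightarrow> 'g::linordered_ab_group_add) \<Rightarrow> 'k set" where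
  "valuation_ring v = {x. x = 0 \<or> 0 \<le> v x}"

definition valuation_ideal :: "('k::field \<Rightarrow> 'g::linordered_ab_group_add) \<Rightarrow> 'k set" where
  "valuation_ideal v = {x. x = 0 \<or> 0 < v x}"

definition val_submodule :: "('k::field \<Rightarrow> 'g::linordered_ab_group_add) \<Rightarrow> 'k set \<Rightarrow> bool" where
  "val_submodule v I \<longleftrightarrow>
     0 \<in> I \<and> (\<forall>x\<in>I. \<forall>y\<in>I. x + y \<in> I) \<and> (\<forall>a\<in>valuation_ring v. \<forall>x\<in>I. a * x \<in> I)"

text \<open>Ideals in the fractional sense: they need not be contained in the valuation ring.\<close>

definition val_ideal :: "('k::field \<Rightarrow> 'g::linordered_ab_group_add) \<Rightarrow> 'k set \<Rightarrow> bool" where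
  "val_ideal v I \<longleftrightarrow> val_submodule v I \<and> I \<noteq> {0} \<and> I \<noteq> UNIV"

definition val_principal :: "('k::field \<Rightarrow> 'g::linordered_ab_group_add) \<Rightarrow> 'k set \<Rightarrow> bool" where
  "val_principal v I \<longleftrightarrow> (\<exists>a. I = (\<lambda>x. a * x) ` valuation_ring v)"

definition val_prod ::
  "('k::field \<Rightarrow> 'g::linordered_ab_group_add) \<Rightarrow> 'k set \<Rightarrow> 'k set \<Rightarrow> 'k set" where
  "val_prod v I J = val_submodule v hull {x * y | x y. x \<in> I \<and> y \<in> J}"

text \<open>
  \<open>quotient_ann I\<^sub>1 I\<^sub>2\<close> is the colon \<open>I\<^sub>2 : I\<^sub>1\<close>, formed in the whole field. For
  \<open>I\<^sub>2 \<subset> I\<^sub>1\<close> it agrees with the annihilator of the module \<open>I\<^sub>1 / I\<^sub>2\<close> in the valuation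
  ring, as the lemma below confirms.
\<close>

definition quotient_ann :: "'k::field set \<Rightarrow> 'k set \<Rightarrow> 'k set" where
  "quotient_ann I1 I2 = {a. \<forall>x\<in>I1. a * x \<in> I2}"

lemma quotient_ann_eq_module_annihilator:
  assumes v: "valuation v" and I2: "val_submodule v I2" and less: "I2 \<subset> I1"
  shows "quotient_ann I1 I2 = {a \<in> valuation_ring v. \<forall>x\<in>I1. a * x \<in> I2}"
proof -
  have "a \<in> valuation_ring v" if a: "\<forall>x\<in>I1. a * x \<in> I2" for a
  proof (rule ccontr)
    assume "a \<notin> valuation_ring v"
    then have a0: "a \<noteq> 0" and neg: "v a < 0"
      by (auto simp: valuation_ring_def)
    have mult: "v (x * y) = v x + v y" if "x \<noteq> 0" "y \<noteq> 0" for x y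
      using v that by (auto simp: valuation_def)
    have "v 1 = 0" using mult[of 1 1] by simp
    then have "v a + v (inverse a) = 0" using mult[of a "inverse a"] a0 by simp
    then have "0 \<le> v (inverse a)"
      using neg by (metis add_neg_neg less_irrefl not_le)
    then have "inverse a \<in> valuation_ring v"
      by (simp add: valuation_ring_def)
    then have "inverse a * (a * x) \<in> I2" if "x \<in> I1" for x
      using I2 a that unfolding val_submodule_def by blast
    then have "I1 \<subseteq> I2" using a0 by (auto simp flip: mult.assoc)
    with less show False by blast
  qed
  then show ?thesis by (auto simp: quotient_ann_def)
qed

end

(* An annihilator equal to the maximal ideal M means M I1 \<subseteq> I2 but not I1 \<subseteq> I2.
   Submodules of K are upward closed for v, so any a \<in> I1 - I2 satisfies I2 \<subseteq> aM; moreover v a is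
   minimal on I1, since an element of I1 of smaller value would put a into M I1 \<subseteq> I2.
   Hence I1 = aO and I2 = aM. The second part is the first one with I1 = I and I2 = IJ: the
   annihilator is proper, so IJ \<noteq> I, and aJ = aM gives J = M. *)
theory Submission
  imports Defs
begin

lemma valuation_mult:
  "valuation v \<Longrightarrow> x \<noteq> 0 \<Longrightarrow> y \<noteq> 0 \<Longrightarrow> v (x * y) = v x + v y"
  by (simp add: valuation_def)

lemma valuation_add:
  "valuation v \<Longrightarrow> x \<noteq> 0 \<Longrightarrow> y \<noteq> 0 \<Longrightarrow> x + y \<noteq> 0 \<Longrightarrow> min (v x) (v y) \<le> v (x + y)"
  by (simp add: valuation_def)

lemma valuation_one: "valuation v \<Longrightarrow> v 1 = 0"
  using valuation_mult[of v 1 1] by simp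

lemma valuation_divide:
  assumes "valuation v" "x \<noteq> 0" "y \<noteq> 0"
  shows "v (x / y) = v x - v y"
  using valuation_mult[of v "x / y" y] assms by (simp add: algebra_simps)

lemma one_in_valuation_ring: "valuation v \<Longrightarrow> 1 \<in> valuation_ring v"
  by (simp add: valuation_ring_def valuation_one)

lemma one_notin_valuation_ideal: "valuation v \<Longrightarrow> 1 \<notin> valuation_ideal v"
  by (simp add: valuation_ideal_def valuation_one)

text \<open>Dividing by \<open>a\<close> shifts values by \<open>v a\<close>, which reduces
  statements about modules generated by one element to comparisons of values. Zero is split off
  because \<open>v 0\<close> is arbitrary.\<close>

lemma mem_times_valuation_ring_iff:
  assumes "valuation v" "a \<noteq> 0"
  shows "x \<in> (*) a ` valuation_ring v \<longleftrightarrow> x = 0 \<or> v a \<le> v x"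
proof
  assume "x \<in> (*) a ` valuation_ring v"
  then obtain b where "x = a * b" "b \<in> valuation_ring v" by blast
  then show "x = 0 \<or> v a \<le> v x"
    using assms by (cases "b = 0") (auto simp: valuation_ring_def valuation_mult)
next
  assume "x = 0 \<or> v a \<le> v x"
  then have "x / a \<in> valuation_ring v"
    using assms by (cases "x = 0") (auto simp: valuation_ring_def valuation_divide)
  then show "x \<in> (*) a ` valuation_ring v"
    using assms by (intro image_eqI[of _ _ "x / a"]) auto
qed

lemma mem_times_valuation_ideal_iff:
  assumes "valuation v" "a \<noteq> 0"
  shows "x \<in> (*) a ` valuation_ideal v \<longleftrightarrow> x = 0 \<or> v a < v x"
proof
  assume "x \<in> (*) a ` valuation_ideal v"
  then obtain b where "x = a * b" "b \<in> valuation_ideal v" by blast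
  then show "x = 0 \<or> v a < v x"
    using assms by (cases "b = 0") (auto simp: valuation_ideal_def valuation_mult)
next
  assume "x = 0 \<or> v a < v x"
  then have "x / a \<in> valuation_ideal v"
    using assms by (cases "x = 0") (auto simp: valuation_ideal_def valuation_divide)
  then show "x \<in> (*) a ` valuation_ideal v"
    using assms by (intro image_eqI[of _ _ "x / a"]) auto
qed

text \<open>The inequality puts \<open>x\<close> into the cyclic module generated by
  \<open>a\<close>, and \<open>I\<close> absorbs multiples by the valuation ring.\<close>

lemma val_submodule_upward_closed:
  assumes "valuation v" "val_submodule v I" "a \<in> I" "a \<noteq> 0" "v a \<le> v x"
  shows "x \<in> I"
proof -
  obtain b where "b \<in> valuation_ring v" "x = a * b"
    using assms mem_times_valuation_ring_iff[of v a x] by auto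
  then show ?thesis
    using assms unfolding val_submodule_def by (metis mult.commute)
qed

lemma val_submodule_valuation_ideal:
  assumes "valuation v"
  shows "val_submodule v (valuation_ideal v)"
proof -
  have "x + y \<in> valuation_ideal v" if "x \<in> valuation_ideal v" "y \<in> valuation_ideal v" for x y
  \<comment> \<open>The ultrametric inequality is available only when both summands and the sum are
    nonzero.\<close>
  proof (cases "x = 0 \<or> y = 0 \<or> x + y = 0")
    case True
    then show ?thesis using that by (auto simp: valuation_ideal_def)
  next
    case False
    then have "0 < min (v x) (v y)" using that by (auto simp: valuation_ideal_def)
    also have "\<dots> \<le> v (x + y)" using False assms by (intro valuation_add) auto
    finally show ?thesis by (simp add: valuation_ideal_def)
  qed
  moreover have "a * x \<in> valuation_ideal v"
    if "a \<in> valuation_ring v" "x \<in> valuation_ideal v" for a x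
    using that assms by (cases "a = 0 \<or> x = 0")
      (auto simp: valuation_ideal_def valuation_ring_def valuation_mult add_nonneg_pos)
  ultimately show ?thesis
    by (auto simp: val_submodule_def valuation_ideal_def)
qed

lemma val_submodule_times:
  assumes "val_submodule v J"
  shows "val_submodule v ((*) a ` J)"
proof -
  have "a * x + a * y \<in> (*) a ` J" if "x \<in> J" "y \<in> J" for x y
    using that assms by (intro image_eqI[of _ _ "x + y"]) (auto simp: val_submodule_def algebra_simps)
  moreover have "b * (a * x) \<in> (*) a ` J" if "b \<in> valuation_ring v" "x \<in> J" for b x
    using that assms by (intro image_eqI[of _ _ "b * x"]) (auto simp: val_submodule_def algebra_simps)
  moreover have "0 \<in> (*) a ` J"
    using assms by (intro image_eqI[of _ _ 0]) (auto simp: val_submodule_def)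
  ultimately show ?thesis
    by (auto simp: val_submodule_def)
qed

text \<open>Submodules are closed under arbitrary intersections, so the hull is itself one.\<close>

lemma val_submodule_val_prod: "val_submodule v (val_prod v I J)"
  unfolding val_prod_def by (rule hull_in) (auto simp: val_submodule_def)

lemma mult_in_val_prod: "x \<in> I \<Longrightarrow> y \<in> J \<Longrightarrow> x * y \<in> val_prod v I J"
  unfolding val_prod_def by (intro hull_inc) auto

lemma val_prod_minimal:
  assumes "val_submodule v N" "\<And>x y. x \<in> I \<Longrightarrow> y \<in> J \<Longrightarrow> x * y \<in> N"
  shows "val_prod v I J \<subseteq> N"
  unfolding val_prod_def using assms by (intro hull_minimal) auto

text \<open>\<open>J\<close> absorbs the ring factor of a product \<open>a * b * y\<close>;
  conversely \<open>a\<close> itself lies in the principal module because the ring contains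
  1.\<close>

lemma val_prod_principal:
  assumes "valuation v" "val_submodule v J"
  shows "val_prod v ((*) a ` valuation_ring v) J = (*) a ` J"
proof
  have "a * b * y \<in> (*) a ` J" if "b \<in> valuation_ring v" "y \<in> J" for b y
    using that assms(2) by (intro image_eqI[of _ _ "b * y"]) (auto simp: val_submodule_def)
  then show "val_prod v ((*) a ` valuation_ring v) J \<subseteq> (*) a ` J"
    using assms(2) by (intro val_prod_minimal val_submodule_times) auto
next
  have "a \<in> (*) a ` valuation_ring v"
    using one_in_valuation_ring[OF assms(1)] by (intro image_eqI[of _ _ 1]) auto
  then show "(*) a ` J \<subseteq> val_prod v ((*) a ` valuation_ring v) J"
    by (auto intro: mult_in_val_prod)
qed

lemma quotient_ann_principal:
  assumes "valuation v" "a \<noteq> 0" "val_submodule v J"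
  shows "quotient_ann ((*) a ` valuation_ring v) ((*) a ` J) = J"
proof -
  \<comment> \<open>Cancelling \<open>a\<close> reduces the claim to the colon of \<open>J\<close>
    by the valuation ring, where testing \<open>b = 1\<close> suffices.\<close>
  have "c * (a * b) \<in> (*) a ` J \<longleftrightarrow> c * b \<in> J" for b c
    using assms(2) by (auto simp: image_iff mult.left_commute)
  then have "quotient_ann ((*) a ` valuation_ring v) ((*) a ` J)
      = {c. \<forall>b\<in>valuation_ring v. c * b \<in> J}"
    by (simp add: quotient_ann_def)
  also have "\<dots> = J"
    using assms(3) one_in_valuation_ring[OF assms(1)]
    by (force simp: val_submodule_def mult.commute)
  finally show ?thesis .
qed

text \<open>The forward direction of both parts rests on this. It speaks of submodules rather than
  ideals so that it applies directly to a product \<open>val_prod v I J\<close>.\<close>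

lemma quotient_ann_eq_valuation_ideal_imp:
  assumes v: "valuation v" and I1: "val_submodule v I1" and I2: "val_submodule v I2"
    and less: "I2 \<subset> I1" and ann: "quotient_ann I1 I2 = valuation_ideal v"
  obtains a where "a \<noteq> 0" "I1 = (*) a ` valuation_ring v" "I2 = (*) a ` valuation_ideal v"
proof -
  obtain a where a: "a \<in> I1" "a \<notin> I2" using less by blast
  have zero: "0 \<in> I1" "0 \<in> I2" using I1 I2 by (auto simp: val_submodule_def)
  with a have a0: "a \<noteq> 0" by auto
  have M: "y * m \<in> I2" if "m \<in> valuation_ideal v" "y \<in> I1" for m y
    using that ann by (auto simp: quotient_ann_def mult.commute)
  have min: "v a \<le> v y" if "y \<in> I1" "y \<noteq> 0" for y
  proof (rule ccontr)
    assume "\<not> v a \<le> v y"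
    \<comment> \<open>A smaller value of \<open>y\<close> makes \<open>a / y\<close> an element of
      the maximal ideal, which annihilates \<open>y\<close> modulo \<open>I2\<close>.\<close>
    then have "a \<in> (*) y ` valuation_ideal v"
      using mem_times_valuation_ideal_iff[OF v] that by auto
    then show False using M that a by blast
  qed
  \<comment> \<open>Otherwise upward closure of \<open>I2\<close>, started at \<open>x\<close>,
    would reach \<open>a\<close>.\<close>
  have "v a < v x" if "x \<in> I2" "x \<noteq> 0" for x
    using val_submodule_upward_closed[OF v I2] that a by (meson not_le)
  then have "I2 = (*) a ` valuation_ideal v"
    using M a mem_times_valuation_ideal_iff[OF v a0] by blast
  moreover have "x \<in> I1 \<longleftrightarrow> x = 0 \<or> v a \<le> v x" for x
    using min zero val_submodule_upward_closed[OF v I1 a(1) a0] by blast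
  then have "I1 = (*) a ` valuation_ring v"
    using mem_times_valuation_ring_iff[OF v a0] by blast
  ultimately show thesis using that a0 by blast
qed

lemma val_principal_idealE:
  assumes "val_ideal v I" "val_principal v I"
  obtains a where "a \<noteq> 0" "I = (*) a ` valuation_ring v"
proof -
  obtain a where a: "I = (*) a ` valuation_ring v"
    using assms(2) by (auto simp: val_principal_def)
  moreover have "a \<noteq> 0"
    using assms(1) a by (auto simp: val_ideal_def val_submodule_def)
  ultimately show thesis using that by blast
qed

text \<open>The backward direction of both parts: for a generator \<open>a\<close>, numerator and
  denominator are the \<open>a\<close>-multiples of the valuation ring and of its maximal ideal, and
  \<open>a\<close> cancels in the colon.\<close>

lemma quotient_ann_val_prod_valuation_ideal:
  assumes "valuation v" "val_ideal v I" "val_principal v I"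
  shows "quotient_ann I (val_prod v I (valuation_ideal v)) = valuation_ideal v"
proof -
  obtain a where "a \<noteq> 0" "I = (*) a ` valuation_ring v"
    using assms val_principal_idealE by blast
  then show ?thesis
    using assms by (simp add: val_prod_principal quotient_ann_principal
        val_submodule_valuation_ideal)
qed

theorem proposition3p17:
  fixes v :: "'k::field \<Rightarrow> 'g::linordered_ab_group_add"
  assumes "valuation v"
  shows
    "(\<forall>I1 I2. val_ideal v I1 \<longrightarrow> val_ideal v I2 \<longrightarrow> I2 \<subset> I1 \<longrightarrow>
        (quotient_ann I1 I2 = valuation_ideal v \<longleftrightarrow>
          val_principal v I1 \<and> I2 = val_prod v I1 (valuation_ideal v))) \<and>
     (\<forall>I J. val_ideal v I \<longrightarrow> val_ideal v J \<longrightarrow> J \<subset> valuation_ring v \<longrightarrow>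
        (quotient_ann I (val_prod v I J) = valuation_ideal v \<longleftrightarrow>
          val_principal v I \<and> J = valuation_ideal v))"
proof (intro conjI allI impI)
  fix I1 I2
  assume I: "val_ideal v I1" "val_ideal v I2" "I2 \<subset> I1"
  show "quotient_ann I1 I2 = valuation_ideal v \<longleftrightarrow>
          val_principal v I1 \<and> I2 = val_prod v I1 (valuation_ideal v)"
  proof
    assume "quotient_ann I1 I2 = valuation_ideal v"
    then obtain a where "I1 = (*) a ` valuation_ring v" "I2 = (*) a ` valuation_ideal v"
      using quotient_ann_eq_valuation_ideal_imp[OF assms] I by (metis val_ideal_def)
    then show "val_principal v I1 \<and> I2 = val_prod v I1 (valuation_ideal v)"
      using assms
      by (auto simp: val_principal_def val_prod_principal val_submodule_valuation_ideal)
  qed (use assms I quotient_ann_val_prod_valuation_ideal in blast)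
next
  fix I J
  assume I: "val_ideal v I" and J: "val_ideal v J" "J \<subset> valuation_ring v"
  have sub: "val_submodule v I" "val_submodule v J"
    using I J by (auto simp: val_ideal_def)
  show "quotient_ann I (val_prod v I J) = valuation_ideal v \<longleftrightarrow>
          val_principal v I \<and> J = valuation_ideal v"
  proof
    assume ann: "quotient_ann I (val_prod v I J) = valuation_ideal v"
    \<comment> \<open>If they were equal, 1 would belong to the annihilator, but 1 has value 0 and
      so lies outside the maximal ideal.\<close>
    have "val_prod v I J \<noteq> I"
      using ann one_notin_valuation_ideal[OF assms] by (auto simp: quotient_ann_def)
    moreover have "x * y \<in> I" if "x \<in> I" "y \<in> J" for x y
      using that sub J by (metis mult.commute psubsetD val_submodule_def)
    then have "val_prod v I J \<subseteq> I"
      using sub by (intro val_prod_minimal)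
    ultimately obtain a where a: "a \<noteq> 0" "I = (*) a ` valuation_ring v"
        "val_prod v I J = (*) a ` valuation_ideal v"
      using quotient_ann_eq_valuation_ideal_imp[OF assms sub(1) val_submodule_val_prod _ ann]
      by blast
    \<comment> \<open>The same product is computed a second time, now from the generator
      \<open>a\<close> of \<open>I\<close>; cancelling \<open>a\<close> then identifies
      \<open>J\<close>.\<close>
    then have "(*) a ` J = (*) a ` valuation_ideal v"
      using val_prod_principal[OF assms sub(2)] by simp
    moreover have "inj ((*) a)"
      using a(1) by (simp add: inj_def)
    ultimately have "J = valuation_ideal v"
      by (simp add: inj_image_eq_iff)
    then show "val_principal v I \<and> J = valuation_ideal v"
      using a by (auto simp: val_principal_def)
  qed (use assms I quotient_ann_val_prod_valuation_ideal in blast)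
qed

end
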